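(* Let $G=(V,E)$ be a weakly connected directed acyclic graph with $n\ge 2$ nodes and fixed delays $m_{i,j}$, and let $(\mathcal{N}^e,\mathcal{N}^m)$ be an identification pattern. If the network $G$ is identifiable in the class $\mathcal{F}_{Z,NL}$ with $(\mathcal{N}^e,\mathcal{N}^m)$, then every node is excited or measured, i.e. $\mathcal{N}^e\cup\mathcal{N}^m=V$.
   Context: Graph. $G=(V,E)$ is a weakly connected directed acyclic graph (DAG), $V=\{1,\dots,n\}$, $E\subseteq V\times V$. An element $(i,j)\in E$ denotes an edge from $j$ to $i$; $\mathcal{N}_i=\{j:(i,j)\in E\}$ is the set of in-neighbors of $i$. Identification pattern. A pair $(\mathcal{N}^e,\mathcal{N}^m)$ with $\mathcal{N}^e\subseteq V$ (excited nodes) and $\mathcal{N}^m\subseteq V$ (measured nodes). Model. Each edge $(i,j)\in E$ carries a fixed known finite delay $m_{i,j}\in\{1,2,\dots\}$ and a function $f_{i,j}:\mathbb{R}\to\mathbb{R}$. The node outputs satisfy, at each time $k$, $$y_i^k=\sum_{j\in\mathcal{N}_i} f_{i,j}\big(y_j^{k-m_{i,j}}\big)+u_i^{k-1},\qquad i\in V,$$ where superscripts denote time instants, $u_i$ is an arbitrary real excitation signal if $i\in\mathcal{N}^e$, and $u_i\equiv 0$ if $i\notin\mathcal{N}^e$. The functions $F_i$. Since $G$ is acyclic, unrolling the model gives $y_i^k=u_i^{k-1}+F_i$, where $F_i$ is a function of finitely many delayed values $u_j^{k-s}$ of the excitation signals of excited nodes $j$ having a path to $i$. Explicitly, $F_i=\sum_{j\in\mathcal{N}_i}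 f_{i,j}\big(u_j^{k-m_{i,j}-1}+F_j^{(m_{i,j})}\big)$, where $F_j^{(s)}$ is $F_j$ with all its inputs delayed by $s$, and $u_j=0$ for non-excited $j$. The set of measured functions is $F(\mathcal{N}^m)=\{F_i: i\in\mathcal{N}^m\}$. For another family $\{\tilde f\}=\{\tilde f_{i,j}\}$ on the same graph with the same delays and pattern, $\tilde F_i$ denotes the corresponding functions; $F(\mathcal{N}^m)=\tilde F(\mathcal{N}^m)$ means $F_i=\tilde F_i$ as functions (for all real values of the inputs) for each $i\in\mathcal{N}^m$. Class $\mathcal{F}_{Z,NL}$. The set of $f:\mathbb{R}\to\mathbb{R}$ such that: (1) $f$ is real analytic on $\mathbb{R}$; (2) $f(0)=0$; (3) the Taylor series $f(x)=\sum_{n\ge1}a_nx^n$ at $0$ has some $a_n\ne0$ with $n>1$; (4) the range of $f$ is $\mathbb{R}$. Identifiability. $G$ is identifiable in $\mathcal{F}_{Z,NL}$ with $(\mathcal{N}^e,\mathcal{N}^m)$ if, for all families $\{f_{i,j}\}_{(i,j)\in E}$ and $\{\tilde f_{i,j}\}_{(i,j)\in E}$ of functions in $\mathcal{F}_{Z,NL}$, $F(\mathcal{N}^m)=\tilde F(\mathcal{N}^m)$ implies $f_{i,j}=\tilde f_{i,j}$ for all $(i,j)\in E$. *)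

theory Defs
  imports "HOL-Analysis.Analysis"
begin

text \<open>
  As in the network equations, a pair \<open>(i, j) \<in> E\<close> is an edge from \<open>j\<close> to \<open>i\<close>.
\<close>

definition in_neighbors :: "(nat \<times> nat) set \<Rightarrow> nat \<Rightarrow> nat set" where
  "in_neighbors E i = {j. (i, j) \<in> E}"

definition weakly_connected :: "nat set \<Rightarrow> (nat \<times> nat) set \<Rightarrow> bool" where
  "weakly_connected V E \<longleftrightarrow> (\<forall>i\<in>V. \<forall>j\<in>V. (i, j) \<in> (E \<union> E\<inverse>)\<^sup>*)"

text \<open>
  Signals are indexed by node and by discrete time, which is unbounded in both directions, so
  that every delayed value \<open>u j (k - s)\<close> is available.
\<close>

type_synonym signal = "nat \<Rightarrow> int \<Rightarrow> real"

definition excitation :: "nat set \<Rightarrow> signal \<Rightarrow> bool" where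
  "excitation Ne u \<longleftrightarrow> (\<forall>j. j \<notin> Ne \<longrightarrow> (\<forall>t. u j t = 0))"

definition network_output ::
  "nat set \<Rightarrow> (nat \<times> nat) set \<Rightarrow> (nat \<Rightarrow> nat \<Rightarrow> nat) \<Rightarrow> (nat \<Rightarrow> nat \<Rightarrow> real \<Rightarrow> real)
    \<Rightarrow> signal \<Rightarrow> signal \<Rightarrow> bool" where
  "network_output V E m f u y \<longleftrightarrow>
    (\<forall>i\<in>V. \<forall>k. y i k = (\<Sum>j\<in>in_neighbors E i. f i j (y j (k - int (m i j)))) + u i (k - 1))"

text \<open>
  \<open>unrolled E m f i u k\<close> is the function \<open>F\<^sub>i\<close> at time \<open>k\<close>, as a function of the excitation signals
  \<open>u\<close>; delaying all inputs of \<open>F\<^sub>j\<close> by \<open>s\<close> amounts to evaluating it at time \<open>k - s\<close>. The recursion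
  is along the edges; the recursion equation is the lemma \<open>unrolled_eq\<close> below.
\<close>

definition unrolled ::
  "(nat \<times> nat) set \<Rightarrow> (nat \<Rightarrow> nat \<Rightarrow> nat) \<Rightarrow> (nat \<Rightarrow> nat \<Rightarrow> real \<Rightarrow> real)
    \<Rightarrow> nat \<Rightarrow> signal \<Rightarrow> int \<Rightarrow> real" where
  "unrolled E m f = wfrec (E\<inverse>) (\<lambda>F i u k.
     \<Sum>j\<in>in_neighbors E i. f i j (u j (k - int (m i j) - 1) + F j u (k - int (m i j))))"

lemma unrolled_eq:
  assumes "finite E" "acyclic E"
  shows "unrolled E m f i u k =
    (\<Sum>j\<in>in_neighbors E i.
       f i j (u j (k - int (m i j) - 1) + unrolled E m f j u (k - int (m i j))))"
proof -
  have wf: "wf (E\<inverse>)"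
    using assms by (rule finite_acyclic_wf_converse)
  show ?thesis
    by (subst unrolled_def, subst wfrec[OF wf])
      (auto simp: cut_apply in_neighbors_def unrolled_def intro!: sum.cong)
qed

lemma network_output_eq_unrolled:
  assumes "finite E" "acyclic E" "E \<subseteq> V \<times> V" "network_output V E m f u y" "i \<in> V"
  shows "y i k = u i (k - 1) + unrolled E m f i u k"
proof -
  have wf: "wf (E\<inverse>)"
    using assms(1,2) by (rule finite_acyclic_wf_converse)
  show ?thesis
    using \<open>i \<in> V\<close>
  proof (induction i arbitrary: k rule: wf_induct_rule[OF wf])
    case (1 i)
    have "y i k = (\<Sum>j\<in>in_neighbors E i. f i j (y j (k - int (m i j)))) + u i (k - 1)"
      using assms(4) 1 by (simp add: network_output_def)
    also have "(\<Sum>j\<in>in_neighbors E i. f i j (y j (k - int (m i j)))) = unrolled E m f i u k"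
      unfolding unrolled_eq[OF assms(1,2), of m f i]
    proof (rule sum.cong)
      fix j assume "j \<in> in_neighbors E i"
      then have "(j, i) \<in> E\<inverse>" "j \<in> V"
        using assms(3) by (auto simp: in_neighbors_def)
      then show "f i j (y j (k - int (m i j))) =
          f i j (u j (k - int (m i j) - 1) + unrolled E m f j u (k - int (m i j)))"
        using "1.IH" by simp
    qed simp
    finally show ?case
      by simp
  qed
qed

text \<open>
  \<open>F\<^sub>i\<close> depends on finitely many delayed inputs only, and these can be prescribed independently of
  each other. Hence equality of \<open>F\<^sub>i\<close> and its counterpart for all real values of the inputs is
  equality for all excitation signals that vanish at the non-excited nodes.
\<close>

definition same_measured_functions ::
  "(nat \<times> nat) set \<Rightarrow> (nat \<Rightarrow> nat \<Rightarrow> nat) \<Rightarrow> nat set \<Rightarrow> nat set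
    \<Rightarrow> (nat \<Rightarrow> nat \<Rightarrow> real \<Rightarrow> real) \<Rightarrow> (nat \<Rightarrow> nat \<Rightarrow> real \<Rightarrow> real) \<Rightarrow> bool" where
  "same_measured_functions E m Ne Nm f g \<longleftrightarrow>
    (\<forall>i\<in>Nm. \<forall>u k. excitation Ne u \<longrightarrow> unrolled E m f i u k = unrolled E m g i u k)"

definition identifiable ::
  "(nat \<times> nat) set \<Rightarrow> (nat \<Rightarrow> nat \<Rightarrow> nat) \<Rightarrow> (real \<Rightarrow> real) set \<Rightarrow> nat set \<Rightarrow> nat set \<Rightarrow> bool" where
  "identifiable E m \<F> Ne Nm \<longleftrightarrow>
    (\<forall>f g. (\<forall>(i, j)\<in>E. f i j \<in> \<F>) \<longrightarrow> (\<forall>(i, j)\<in>E. g i j \<in> \<F>) \<longrightarrow>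
       same_measured_functions E m Ne Nm f g \<longrightarrow> (\<forall>(i, j)\<in>E. f i j = g i j))"

definition real_analytic :: "(real \<Rightarrow> real) \<Rightarrow> bool" where
  "real_analytic f \<longleftrightarrow> (\<forall>x. \<exists>A. (\<lambda>h. f (x + h)) has_fps_expansion A)"

definition F_ZNL :: "(real \<Rightarrow> real) set" where
  "F_ZNL = {f. real_analytic f \<and> f 0 = 0 \<and>
     (\<exists>A. f has_fps_expansion A \<and> (\<exists>n>1. fps_nth A n \<noteq> 0)) \<and> range f = UNIV}"

end

theory Submission
  imports Defs
begin

text \<open>
  The output of an unexcited, unmeasured node \<open>p\<close> can be rescaled without any visible effect:
  multiply the functions on the edges into \<open>p\<close> by \<open>2\<close> and the arguments of the functions on the
  edges out of \<open>p\<close> by \<open>1 / 2\<close>. Applied to the family \<open>x ^ 3\<close> this changes the function on every edge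
  at \<open>p\<close>, and such an edge exists by weak connectedness.
\<close>

text \<open>By induction along the edges, the factor \<open>s j\<close> gained by the output of
  \<open>j\<close> is cancelled by the division inside the function on the edge leaving
  \<open>j\<close>. Only \<open>s i\<close> survives.\<close>

lemma unrolled_rescale:
  assumes "finite E" "acyclic E" "excitation Ne u"
    and s: "\<And>i. s i \<noteq> 0" "\<And>i. i \<in> Ne \<Longrightarrow> s i = 1"
  shows "unrolled E m (\<lambda>i j x. s i * f i j (x / s j)) i u k = s i * unrolled E m f i u k"
proof -
  have wf: "wf (E\<inverse>)"
    using assms(1,2) by (rule finite_acyclic_wf_converse)
  show ?thesis
  proof (induction i arbitrary: k rule: wf_induct_rule[OF wf])
    case (1 i)
    \<comment> \<open>The division must also leave the input at \<open>j\<close> unchanged: either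
      \<open>s j = 1\<close>, or \<open>j\<close> is unexcited and the input is
      \<open>0\<close>.\<close>
    have u: "u j t / s j = u j t" for j t
      using assms(3) s(2)[of j] by (cases "j \<in> Ne") (auto simp: excitation_def)
    show ?case
      unfolding unrolled_eq[OF assms(1,2), of m _ i] sum_distrib_left
    proof (rule sum.cong)
      fix j assume "j \<in> in_neighbors E i"
      then have "(j, i) \<in> E\<inverse>"
        by (simp add: in_neighbors_def)
      then show "s i * f i j ((u j (k - int (m i j) - 1) +
            unrolled E m (\<lambda>i j x. s i * f i j (x / s j)) j u (k - int (m i j))) / s j) =
          s i * f i j (u j (k - int (m i j) - 1) + unrolled E m f j u (k - int (m i j)))"
        using "1.IH" s(1)[of j] by (simp add: add_divide_distrib u)
    qed simp
  qed
qed

text \<open>Cubes are nonlinear, onto the reals because the exponent is odd, and stable under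
  rescaling of argument and value.\<close>

lemma cubic_in_F_ZNL:
  fixes c :: real
  assumes "c \<noteq> 0"
  shows "(\<lambda>x. c * x ^ 3) \<in> F_ZNL"
proof -
  have expansion: "(\<lambda>h. c * (x + h) ^ 3) has_fps_expansion fps_const c * (fps_const x + fps_X) ^ 3"
    for x
    unfolding power3_eq_cube by (intro fps_expansion_intros)
  have "(\<lambda>x. c * x ^ 3) has_fps_expansion fps_const c * fps_X ^ 3"
    using expansion[of 0] by simp
  moreover have "(1::nat) < 3 \<and> fps_nth (fps_const c * fps_X ^ 3) 3 \<noteq> 0"
    using assms by simp
  ultimately have "\<exists>A. (\<lambda>x. c * x ^ 3) has_fps_expansion A \<and> (\<exists>n>1. fps_nth A n \<noteq> 0)"
    by blast
  moreover have "y \<in> range (\<lambda>x. c * x ^ 3)" for y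
    using assms by (intro image_eqI[of _ _ "root 3 (y / c)"]) (simp_all add: odd_real_root_pow)
  then have "range (\<lambda>x. c * x ^ 3) = UNIV"
    by blast
  moreover have "real_analytic (\<lambda>x. c * x ^ 3)"
    using expansion unfolding real_analytic_def by blast
  ultimately show ?thesis
    by (simp add: F_ZNL_def)
qed

theorem proposition1:
  fixes n :: nat and E :: "(nat \<times> nat) set" and m :: "nat \<Rightarrow> nat \<Rightarrow> nat" and Ne Nm :: "nat set"
  assumes "n \<ge> 2"
    and "E \<subseteq> {1..n} \<times> {1..n}"
    and "acyclic E"
    and "weakly_connected {1..n} E"
    and "\<forall>(i, j)\<in>E. m i j \<ge> 1"
    and "Ne \<subseteq> {1..n}"
    and "Nm \<subseteq> {1..n}"
    and "identifiable E m F_ZNL Ne Nm"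
  shows "Ne \<union> Nm = {1..n}"
proof (rule ccontr)
  assume "Ne \<union> Nm \<noteq> {1..n}"
  then obtain p where p: "p \<in> {1..n}" "p \<notin> Ne" "p \<notin> Nm"
    using assms(6,7) by blast
  have "finite E"
    using assms(2) by (rule finite_subset) simp
  define s :: "nat \<Rightarrow> real" where "s i = (if i = p then 2 else 1)" for i
  define f :: "nat \<Rightarrow> nat \<Rightarrow> real \<Rightarrow> real" where "f i j x = x ^ 3" for i j x
  define g where "g i j x = s i * f i j (x / s j)" for i j x
  have "f i j \<in> F_ZNL" for i j
    using cubic_in_F_ZNL[of 1] by (simp add: f_def[abs_def])
  \<comment> \<open>Here \<open>g i j x = (s i / s j ^ 3) * x ^ 3\<close>.\<close>
  moreover have "g i j \<in> F_ZNL" for i j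
    using cubic_in_F_ZNL[of "s i / s j ^ 3"]
    by (simp add: g_def[abs_def] f_def s_def power_divide)
  moreover have "same_measured_functions E m Ne Nm f g"
    unfolding same_measured_functions_def
  proof (intro ballI allI impI)
    fix i u k assume "i \<in> Nm" and u: "excitation Ne u"
    have "unrolled E m g i u k = s i * unrolled E m f i u k"
      unfolding g_def[abs_def] using p
      by (intro unrolled_rescale[OF \<open>finite E\<close> assms(3) u]) (auto simp: s_def)
    with \<open>i \<in> Nm\<close> p show "unrolled E m f i u k = unrolled E m g i u k"
      by (auto simp: s_def)
  qed
  ultimately have "\<forall>(i, j)\<in>E. f i j = g i j"
    using assms(8)[unfolded identifiable_def, rule_format, of f g] by simp
  then have eq: "f i j 1 = g i j 1" if "(i, j) \<in> E" for i j
    using that by auto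
  \<comment> \<open>A second node makes the undirected path from \<open>p\<close> nontrivial; its
    first step is an edge at \<open>p\<close>, in one direction or the other.\<close>
  obtain q where "q \<in> {1..n}" "q \<noteq> p"
    using assms(1) by (cases "p = 1") (auto intro: that[of 1] that[of 2])
  then have "(p, q) \<in> (E \<union> E\<inverse>)\<^sup>*"
    using assms(4) p unfolding weakly_connected_def by blast
  then obtain r where r: "(p, r) \<in> E \<or> (r, p) \<in> E"
    using \<open>q \<noteq> p\<close> by (cases rule: converse_rtranclE) auto
  \<comment> \<open>With no loop at \<open>p\<close>, \<open>s r = 1\<close>. At \<open>1\<close>
    the value of \<open>g\<close> is \<open>2\<close> on an edge into \<open>p\<close> and
    \<open>1 / 8\<close> on an edge out of \<open>p\<close>, while \<open>f\<close> gives
    \<open>1\<close>.\<close>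
  have "r \<noteq> p"
    using assms(3) r by (auto simp: acyclic_def)
  with r eq[of p r] eq[of r p] show False
    by (auto simp: f_def g_def s_def power_divide)
qed

end
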